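(* Let $f:\mathbb{Z}_+\to\mathbb{Z}_+$ be a nondecreasing recognizable function. Then there exists a $\mathbb{Z}^2$ subshift of finite type whose block gluing function $B$ satisfies $B(n)/f(n)\to 1$ as $n\to\infty$.
   Context: $\mathbb{Z}_+$ is the set of positive integers. Recognizability. A picture over a finite alphabet $A$ is a function $p:\{0,\dots,m-1\}\times\{0,\dots,n-1\}\to A$ with $m,n\ge 1$; its shape is $(m,n)$ (the first coordinate is horizontal, the second increases upward). Let $\#\notin A$ be a special symbol; the padded picture $\hat p$ is the $(m+2)\times(n+2)$ pattern obtained by surrounding $p$ with a border of $\#$'s of thickness one. A domino language over $A$ is given by a set of forbidden horizontal dominoes ($2\times1$ patterns) and vertical dominoes ($1\times 2$ patterns) over $A\cup\{\#\}$, and consists of all pictures $p$ over $A$ such that no forbidden domino occurs in $\hat p$. A set $R\subseteq\mathbb{Z}_+^2$ is recognizable if it is the set of shapes of pictures in some domino language (over some finite alphabet). A function $f:\mathbb{Z}_+\to\mathbb{Z}_+$ is (picture language) recognizable if its graph $\{(m,f(m)) : m\in\mathbb{Z}_+\}$ is recognizable. Block gluing. A $\mathbb{Z}^2$-subshift over a finite alphabet $A$ is a closed shift-invariant set $X\subseteq A^{\mathbb{Z}^2}$; it is of finite type (SFT) if it is defined by finitely many forbidden finite patterns. $\mathcal{L}_n(X)$ denotes the set of $n\times n$ patterns occurring in configurations of $X$. $B_H(n)\in\mathbb{N}\cup\{\infty\}$ is the smallest $k\in\mathbb N$ such that for every $k'\ge k$ and all $p,q\in\mathcal{L}_n(X)$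 there is $x\in X$ containing $p$ with lower left corner at $(0,0)$ and $q$ with lower left corner at $(n+k',0)$ (a gap of $k'$ columns); $B_H(n)=\infty$ if no such $k$ exists. $B_V(n)$ is defined in the same way with $(0,n+k')$ in place of $(n+k',0)$. The block gluing function of $X$ is $B(n)=\max(B_H(n),B_V(n))$. *)

theory Defs
  imports "HOL-Analysis.Analysis"
begin

text \<open>A pattern is a partial map on the grid. The first coordinate is horizontal, the second
  increases upward, and the position of a rectangular pattern is that of its lower left corner.\<close>

type_synonym 'a pattern = "int \<times> int \<rightharpoonup> 'a"
type_synonym 'a configuration = "int \<times> int \<Rightarrow> 'a"

definition rectangle :: "nat \<Rightarrow> nat \<Rightarrow> (int \<times> int) set" where
  "rectangle m n = {0..<int m} \<times> {0..<int n}"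

definition occurs_at :: "'a pattern \<Rightarrow> int \<times> int \<Rightarrow> 'a pattern \<Rightarrow> bool" where
  "occurs_at p v P \<longleftrightarrow> (\<forall>u \<in> dom p. P (u + v) = p u)"

definition occurs_in :: "'a pattern \<Rightarrow> 'a pattern \<Rightarrow> bool" where
  "occurs_in p P \<longleftrightarrow> (\<exists>v. occurs_at p v P)"

abbreviation total_pattern :: "'a configuration \<Rightarrow> 'a pattern" where
  "total_pattern x \<equiv> (\<lambda>u. Some (x u))"

definition is_picture :: "'a set \<Rightarrow> nat \<Rightarrow> nat \<Rightarrow> 'a pattern \<Rightarrow> bool" where
  "is_picture A m n p \<longleftrightarrow> 1 \<le> m \<and> 1 \<le> n \<and> dom p = rectangle m n \<and> ran p \<subseteq> A"

text \<open>The alphabet extended by the border symbol \<open>#\<close> is modelled by the option type, with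
  \<open>#\<close> being \<open>None\<close>. The outer option in the type of a padded picture only expresses that
  it is a partial map; as a picture \<open>p\<close> is \<open>None\<close> outside its domain, \<open>Some (p u)\<close> is
  the border symbol there.\<close>

definition padded :: "nat \<Rightarrow> nat \<Rightarrow> 'a pattern \<Rightarrow> 'a option pattern" where
  "padded m n p = (\<lambda>u. if u \<in> {-1..int m} \<times> {-1..int n} then Some (p u) else None)"

definition hdomino :: "'b \<times> 'b \<Rightarrow> 'b pattern" where
  "hdomino d = [(0, 0) \<mapsto> fst d, (1, 0) \<mapsto> snd d]"

definition vdomino :: "'b \<times> 'b \<Rightarrow> 'b pattern" where
  "vdomino d = [(0, 0) \<mapsto> fst d, (0, 1) \<mapsto> snd d]"

definition with_border :: "'a set \<Rightarrow> 'a option set" where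
  "with_border A = insert None (Some ` A)"

definition in_domino_language ::
  "'a set \<Rightarrow> ('a option \<times> 'a option) set \<Rightarrow> ('a option \<times> 'a option) set
    \<Rightarrow> nat \<Rightarrow> nat \<Rightarrow> 'a pattern \<Rightarrow> bool" where
  "in_domino_language A H V m n p \<longleftrightarrow>
     is_picture A m n p \<and>
     (\<forall>d \<in> H. \<not> occurs_in (hdomino d) (padded m n p)) \<and>
     (\<forall>d \<in> V. \<not> occurs_in (vdomino d) (padded m n p))"

text \<open>Finite sets of natural numbers serve as alphabets; up to renaming of symbols these are
  all finite alphabets.\<close>

definition recognizable :: "(nat \<times> nat) set \<Rightarrow> bool" where
  "recognizable R \<longleftrightarrow>
     (\<exists>(A :: nat set) H V. finite A \<and>
        H \<subseteq> with_border A \<times> with_border A \<and> V \<subseteq> with_border A \<times> with_border A \<and>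
        R = {(m, n). \<exists>p. in_domino_language A H V m n p})"

definition recognizable_function :: "(nat \<Rightarrow> nat) \<Rightarrow> bool" where
  "recognizable_function f \<longleftrightarrow> recognizable {(m, f m) | m. 0 < m}"

definition is_subshift :: "'a set \<Rightarrow> 'a configuration set \<Rightarrow> bool" where
  "is_subshift A X \<longleftrightarrow>
     finite A \<and>
     closedin (product_topology (\<lambda>_. discrete_topology A) UNIV) X \<and>
     (\<forall>x \<in> X. \<forall>v. (\<lambda>u. x (u + v)) \<in> X)"

definition is_SFT :: "'a set \<Rightarrow> 'a configuration set \<Rightarrow> bool" where
  "is_SFT A X \<longleftrightarrow>
     is_subshift A X \<and>
     (\<exists>F. finite F \<and> (\<forall>p \<in> F. finite (dom p) \<and> ran p \<subseteq> A) \<and>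
        X = {x. range x \<subseteq> A \<and> (\<forall>p \<in> F. \<not> occurs_in p (total_pattern x))})"

definition square_patterns :: "'a configuration set \<Rightarrow> nat \<Rightarrow> 'a pattern set" where
  "square_patterns X n =
     {p. dom p = rectangle n n \<and> (\<exists>x \<in> X. occurs_in p (total_pattern x))}"

definition glues_at :: "'a configuration set \<Rightarrow> nat \<Rightarrow> int \<times> int \<Rightarrow> bool" where
  "glues_at X n v \<longleftrightarrow>
     (\<forall>p \<in> square_patterns X n. \<forall>q \<in> square_patterns X n.
        \<exists>x \<in> X. occurs_at p (0, 0) (total_pattern x) \<and> occurs_at q v (total_pattern x))"

definition least_or_infinity :: "(nat \<Rightarrow> bool) \<Rightarrow> enat" where
  "least_or_infinity P = (if \<exists>k. P k then enat (LEAST k. P k) else \<infinity>)"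

definition gluing_H :: "'a configuration set \<Rightarrow> nat \<Rightarrow> enat" where
  "gluing_H X n = least_or_infinity (\<lambda>k. \<forall>k' \<ge> k. glues_at X n (int (n + k'), 0))"

definition gluing_V :: "'a configuration set \<Rightarrow> nat \<Rightarrow> enat" where
  "gluing_V X n = least_or_infinity (\<lambda>k. \<forall>k' \<ge> k. glues_at X n (0, int (n + k')))"

definition block_gluing :: "'a configuration set \<Rightarrow> nat \<Rightarrow> enat" where
  "block_gluing X n = max (gluing_H X n) (gluing_V X n)"

end

theory Submission
  imports Defs
begin

text \<open>Configurations consist of row segments of pictures stacked on top of each other, with marked
  left and right walls, bottom rows and top rows. Stacks may start anywhere. Above a segment that
  is not a top row there is a continuation of the picture, or the bottom row of a new picture, or,
  if an end of the segment has no wall, a row erasing the segment from that end. A bottom row of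
  width \<open>n\<close> with both walls can only be got rid of by a complete picture of width \<open>n\<close>, which has
  height \<open>f n\<close>; hence vertical gaps of about \<open>f n\<close> are necessary. They suffice: cutting an
  \<open>n \<times> n\<close> pattern out of a configuration only removes walls, and the segments of its top row are
  either erased at once or closed off by restarting a picture, whose width \<open>m \<le> n\<close> gives
  \<open>f m \<le> f n\<close>. For unbounded \<open>f\<close> the bounded error is harmless; an eventually constant \<open>f\<close> is
  attained exactly by a shift of horizontal countdowns.\<close>

section \<open>Nearest-neighbour shifts\<close>

text \<open>Allowed pairs of neighbours take the place of forbidden patterns, so that membership is
  checked cell by cell. Every shift constructed below has this form.\<close>

definition nn_shift ::
  "'a set \<Rightarrow> ('a \<Rightarrow> 'a \<Rightarrow> bool) \<Rightarrow> ('a \<Rightarrow> 'a \<Rightarrow> bool) \<Rightarrow> 'a configuration set" where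
  "nn_shift A h v = {x. \<forall>u. x u \<in> A \<and> h (x u) (x (u + (1, 0))) \<and> v (x u) (x (u + (0, 1)))}"

lemma nn_shiftI:
  assumes "\<And>i j. x (i, j) \<in> A" "\<And>i j. h (x (i, j)) (x (i + 1, j))"
    and "\<And>i j. v (x (i, j)) (x (i, j + 1))"
  shows "x \<in> nn_shift A h v"
  using assms by (auto simp: nn_shift_def)

lemma nn_shiftD:
  assumes "x \<in> nn_shift A h v"
  shows "x (i, j) \<in> A" "h (x (i, j)) (x (i + 1, j))" "v (x (i, j)) (x (i, j + 1))"
proof -
  have "x (i, j) \<in> A \<and> h (x (i, j)) (x ((i, j) + (1, 0))) \<and> v (x (i, j)) (x ((i, j) + (0, 1)))"
    using assms unfolding nn_shift_def by blast
  then show "x (i, j) \<in> A" "h (x (i, j)) (x (i + 1, j))" "v (x (i, j)) (x (i, j + 1))" by auto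
qed

lemma nn_shift_translate:
  assumes "x \<in> nn_shift A h v"
  shows "(\<lambda>u. x (u + w)) \<in> nn_shift A h v"
proof -
  have "x (u + w) \<in> A \<and> h (x (u + w)) (x (u + w + (1, 0))) \<and> v (x (u + w)) (x (u + w + (0, 1)))"
    for u using assms unfolding nn_shift_def by blast
  moreover have "u + z + w = u + w + z" for u z by (simp add: ac_simps)
  ultimately show ?thesis by (simp only: nn_shift_def mem_Collect_eq) blast
qed

lemma occurs_in_hdomino:
  "occurs_in (hdomino d) P \<longleftrightarrow> (\<exists>i j. P (i, j) = Some (fst d) \<and> P (i + 1, j) = Some (snd d))"
  by (auto simp: occurs_in_def occurs_at_def hdomino_def add.commute)

lemma occurs_in_vdomino:
  "occurs_in (vdomino d) P \<longleftrightarrow> (\<exists>i j. P (i, j) = Some (fst d) \<and> P (i, j + 1) = Some (snd d))"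
  by (auto simp: occurs_in_def occurs_at_def vdomino_def add.commute)

text \<open>A violation is visible on three cells, a cell with its right and upper neighbours;
  fixing these gives a basic open set that avoids the shift.\<close>

lemma closedin_nn_shift:
  "closedin (product_topology (\<lambda>_. discrete_topology A) UNIV) (nn_shift A h v)"
proof -
  let ?T = "product_topology (\<lambda>_. discrete_topology A) (UNIV :: (int \<times> int) set)"
  have "openin ?T (topspace ?T - nn_shift A h v)"
    unfolding openin_product_topology_alt
  proof
    fix x assume x: "x \<in> topspace ?T - nn_shift A h v"
    then have xA: "x u \<in> A" for u by auto
    from x xA obtain u where u: "\<not> (h (x u) (x (u + (1, 0))) \<and> v (x u) (x (u + (0, 1))))"
      unfolding nn_shift_def by blast
    define K where "K = {u, u + (1, 0), u + (0, 1)}"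
    define U where "U w = (if w \<in> K then {x w} else A)" for w
    have "finite {w \<in> UNIV. U w \<noteq> topspace (discrete_topology A)}"
      by (rule finite_subset[of _ K]) (auto simp: U_def K_def)
    moreover have "\<forall>w\<in>UNIV. openin (discrete_topology A) (U w)"
      using xA by (auto simp: U_def)
    moreover have "x \<in> Pi\<^sub>E UNIV U" using xA by (auto simp: U_def)
    moreover have "Pi\<^sub>E UNIV U \<subseteq> topspace ?T - nn_shift A h v"
    proof
      fix y assume y: "y \<in> Pi\<^sub>E UNIV U"
      then have yU: "y w \<in> U w" for w by auto
      have "y w = x w" if "w \<in> K" for w using yU[of w] that by (simp add: U_def)
      then have "y u = x u" "y (u + (1, 0)) = x (u + (1, 0))" "y (u + (0, 1)) = x (u + (0, 1))"
        by (simp_all add: K_def)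
      then have "y \<notin> nn_shift A h v" using u unfolding nn_shift_def mem_Collect_eq by metis
      moreover have "y w \<in> A" for w using yU[of w] xA[of w] by (auto simp: U_def split: if_splits)
      ultimately show "y \<in> topspace ?T - nn_shift A h v" by auto
    qed
    ultimately show "\<exists>U. finite {i \<in> UNIV. U i \<noteq> topspace (discrete_topology A)} \<and>
        (\<forall>i\<in>UNIV. openin (discrete_topology A) (U i)) \<and> x \<in> Pi\<^sub>E UNIV U \<and>
        Pi\<^sub>E UNIV U \<subseteq> topspace ?T - nn_shift A h v" by blast
  qed
  moreover have "nn_shift A h v \<subseteq> topspace ?T" by (auto simp: nn_shift_def)
  ultimately show ?thesis by (simp add: closedin_def)
qed

lemma is_SFT_nn_shift:
  assumes "finite A"
  shows "is_SFT A (nn_shift A h v)"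
proof -
  let ?F = "hdomino ` {d \<in> A \<times> A. \<not> h (fst d) (snd d)} \<union> vdomino ` {d \<in> A \<times> A. \<not> v (fst d) (snd d)}"
  have "finite ?F" using assms by auto
  moreover have "\<forall>p\<in>?F. finite (dom p) \<and> ran p \<subseteq> A"
    by (auto simp: hdomino_def vdomino_def ran_def split: if_splits)
  moreover have "nn_shift A h v =
      {x. range x \<subseteq> A \<and> (\<forall>p\<in>?F. \<not> occurs_in p (total_pattern x))}"
    by (auto simp: nn_shift_def ball_Un occurs_in_hdomino occurs_in_vdomino subset_iff)
      blast+
  ultimately have "\<exists>F. finite F \<and> (\<forall>p\<in>F. finite (dom p) \<and> ran p \<subseteq> A) \<and>
      nn_shift A h v = {x. range x \<subseteq> A \<and> (\<forall>p\<in>F. \<not> occurs_in p (total_pattern x))}"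
    by blast
  then show ?thesis
    unfolding is_SFT_def is_subshift_def
    using assms closedin_nn_shift[of A h v] nn_shift_translate[of _ A h v] by blast
qed

text \<open>Serves to recode the alphabet of cells by natural numbers: the recoded shift obeys the
  old rules pulled back along \<open>inv e\<close>, so it is again a nearest-neighbour
  shift.\<close>

lemma nn_shift_rename:
  assumes "inj e"
  shows "(\<lambda>x. e \<circ> x) ` nn_shift A h v =
    nn_shift (e ` A) (\<lambda>s t. h (inv e s) (inv e t)) (\<lambda>s t. v (inv e s) (inv e t))"
    (is "?L = ?R")
proof
  show "?L \<subseteq> ?R" using assms by (auto simp: nn_shift_def)
  show "?R \<subseteq> ?L"
  proof
    fix y assume y: "y \<in> ?R"
    then have yA: "y u \<in> e ` A" for u unfolding nn_shift_def by blast
    then have *: "inv e (y u) \<in> A \<and> e (inv e (y u)) = y u" for u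
      using assms by (metis f_inv_into_f image_iff inv_f_f)
    then have "(\<lambda>u. inv e (y u)) \<in> nn_shift A h v" using y by (simp add: nn_shift_def)
    moreover have "y = e \<circ> (\<lambda>u. inv e (y u))" using * by auto
    ultimately show "y \<in> ?L" by blast
  qed
qed

section \<open>Gluing\<close>

text \<open>By shift invariance every occurring pattern also occurs at the origin, so patterns can
  be replaced by configurations restricted to the square.\<close>

lemma glues_at_iff:
  assumes "\<forall>x\<in>X. \<forall>w. (\<lambda>u. x (u + w)) \<in> X"
  shows "glues_at X n v \<longleftrightarrow> (\<forall>x\<in>X. \<forall>y\<in>X. \<exists>z\<in>X.
    (\<forall>u\<in>rectangle n n. z u = x u) \<and> (\<forall>u\<in>rectangle n n. z (u + v) = y u))" (is "?L \<longleftrightarrow> ?R")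
proof -
  have sq: "square_patterns X n = (\<lambda>x. (\<lambda>u. Some (x u)) |` rectangle n n) ` X" (is "_ = ?g ` X")
  proof (intro equalityI subsetI)
    fix p assume "p \<in> square_patterns X n"
    then obtain x w where d: "dom p = rectangle n n" and x: "x \<in> X"
      and w: "occurs_at p w (total_pattern x)"
      unfolding square_patterns_def occurs_in_def by blast
    have p: "p u = Some (x (u + w))" if "u \<in> rectangle n n" for u
      using w that d by (simp add: occurs_at_def)
    have "p = ?g (\<lambda>u. x (u + w))"
    proof
      fix u show "p u = ?g (\<lambda>u. x (u + w)) u"
        using d p[of u] by (cases "u \<in> rectangle n n") (auto simp: restrict_map_def)
    qed
    moreover have "(\<lambda>u. x (u + w)) \<in> X" using assms x by blast
    ultimately show "p \<in> ?g ` X" by (rule image_eqI)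
  next
    fix p assume "p \<in> ?g ` X"
    then obtain x where x: "x \<in> X" "p = ?g x" by blast
    then have "occurs_at p (0, 0) (total_pattern x)"
      by (auto simp: occurs_at_def restrict_map_def split: if_splits simp flip: zero_prod_def)
    moreover have "dom p = rectangle n n" using x by (simp add: dom_restrict)
    ultimately show "p \<in> square_patterns X n"
      using x unfolding square_patterns_def occurs_in_def by blast
  qed
  have "occurs_at (?g x) w (total_pattern z) \<longleftrightarrow> (\<forall>u\<in>rectangle n n. z (u + w) = x u)" for x z w
    by (auto simp: occurs_at_def restrict_map_def dom_def)
  then show ?thesis
    unfolding glues_at_def sq by (simp flip: zero_prod_def)
qed

lemma glues_at_rename:
  assumes "inj e" and X: "\<forall>x\<in>X. \<forall>w. (\<lambda>u. x (u + w)) \<in> X"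
  shows "glues_at ((\<lambda>x. e \<circ> x) ` X) n v = glues_at X n v"
proof -
  have "\<forall>x\<in>(\<lambda>x. e \<circ> x) ` X. \<forall>w. (\<lambda>u. x (u + w)) \<in> (\<lambda>x. e \<circ> x) ` X"
    using X by (auto simp: image_iff o_def)
  from glues_at_iff[OF this] glues_at_iff[OF X] show ?thesis
    using inj_eq[OF assms(1)] by simp
qed

lemma block_gluing_rename:
  assumes "inj e" and "\<forall>x\<in>X. \<forall>w. (\<lambda>u. x (u + w)) \<in> X"
  shows "block_gluing ((\<lambda>x. e \<circ> x) ` X) n = block_gluing X n"
  by (simp add: block_gluing_def gluing_H_def gluing_V_def glues_at_rename[OF assms])

lemma least_or_infinity_le: "P k \<Longrightarrow> least_or_infinity P \<le> enat k"
  by (auto simp: least_or_infinity_def intro: Least_le)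

lemma least_or_infinity_ge:
  assumes "\<And>k. P k \<Longrightarrow> m \<le> k"
  shows "enat m \<le> least_or_infinity P"
  using assms by (auto simp: least_or_infinity_def intro: LeastI2_ex)

lemma block_gluing_le:
  assumes "\<And>k'. k \<le> k' \<Longrightarrow> glues_at X n (int (n + k'), 0)"
    and "\<And>k'. k \<le> k' \<Longrightarrow> glues_at X n (0, int (n + k'))"
  shows "block_gluing X n \<le> enat k"
  unfolding block_gluing_def gluing_H_def gluing_V_def
  using assms by (auto intro!: least_or_infinity_le)

text \<open>The least admissible gap is itself a gap at which gluing succeeds, so it is enough to
  bound single successful gaps, and in one direction only, as \<open>block_gluing\<close> is a
  maximum.\<close>

lemma block_gluing_ge_V:
  assumes "\<And>k. glues_at X n (0, int (n + k)) \<Longrightarrow> m \<le> k"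
  shows "enat m \<le> block_gluing X n"
  unfolding block_gluing_def gluing_V_def
  by (rule max.coboundedI2, rule least_or_infinity_ge) (use assms in blast)

lemma block_gluing_ge_H:
  assumes "\<And>k. glues_at X n (int (n + k), 0) \<Longrightarrow> m \<le> k"
  shows "enat m \<le> block_gluing X n"
  unfolding block_gluing_def gluing_H_def
  by (rule max.coboundedI1, rule least_or_infinity_ge) (use assms in blast)

section \<open>Bounded functions\<close>

text \<open>A symbol s >= 2 forces the run s, s - 1, ..., 1, while 0 and 1 may precede anything. The
  largest symbol \<open>c + 1\<close> thus determines exactly \<open>c\<close> further cells to its
  right; the vertical direction is free.\<close>

definition countdown_shift :: "nat \<Rightarrow> nat configuration set" where
  "countdown_shift c = nn_shift {0..c + 1} (\<lambda>s t. 2 \<le> s \<longrightarrow> t = s - 1) (\<lambda>_ _. True)"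

lemma block_gluing_countdown_shift:
  assumes "0 < n"
  shows "block_gluing (countdown_shift c) n = enat c"
proof (rule antisym)
  let ?X = "countdown_shift c"
  have inv: "\<forall>x\<in>?X. \<forall>w. (\<lambda>u. x (u + w)) \<in> ?X"
    unfolding countdown_shift_def by (blast intro: nn_shift_translate)
  note glue = glues_at_iff[OF inv]
  show "block_gluing ?X n \<le> enat c"
  proof (rule block_gluing_le; unfold glue; intro ballI)
    fix k x y assume k: "c \<le> k" and x: "x \<in> ?X" and y: "y \<in> ?X"
    note xD = nn_shiftD[OF x[unfolded countdown_shift_def]]
      and yD = nn_shiftD[OF y[unfolded countdown_shift_def]]
    \<comment> \<open>The gap continues the countdowns that leave the last column of the square;
      subtraction on naturals stops at the free symbol 0.\<close>
    define z where "z = (\<lambda>(i, j). if i < int n then x (i, j)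
      else if i < int (n + k) then x (int n - 1, j) - nat (i - int n + 1)
      else y (i - int (n + k), j))"
    have "z \<in> ?X" unfolding countdown_shift_def
    proof (rule nn_shiftI)
      fix i j
      show "z (i, j) \<in> {0..c + 1}"
        using xD(1)[of i j] xD(1)[of "int n - 1" j] yD(1)[of "i - int (n + k)" j]
        by (auto simp: z_def)
      have last: "x (int n - 1, j) \<le> c + 1" using xD(1)[of "int n - 1" j] by auto
      consider "i + 1 < int n" | "i + 1 = int n" | "int n \<le> i" "i + 1 < int (n + k)"
        | "int n \<le> i" "i + 1 = int (n + k)" | "int (n + k) \<le> i" by linarith
      then show "2 \<le> z (i, j) \<longrightarrow> z (i + 1, j) = z (i, j) - 1"
      proof cases
        case 1 then show ?thesis using xD(2)[of i j] by (simp add: z_def)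
      next
        case 2
        then have "i = int n - 1" by simp
        then show ?thesis using last k by (auto simp: z_def)
      next
        case 3 
        then have "nat (i + 1 - int n + 1) = Suc (nat (i - int n + 1))" by linarith
        then show ?thesis using 3 by (simp add: z_def)
      next
        \<comment> \<open>After k >= c columns a countdown from at most \<open>c + 1\<close> has
          come down to at most 1, so \<open>y\<close> may follow.\<close>
        case 4
        then have "i = int n + int k - 1" by simp
        then show ?thesis using last k 4 by (auto simp: z_def)
      next
        case 5
        then show ?thesis using yD(2)[of "i - int (n + k)" j] 
          by (simp add: z_def algebra_simps)
      qed
    qed simp
    moreover have "\<forall>u\<in>rectangle n n. z u = x u"
      by (auto simp: rectangle_def z_def)
    moreover have "\<forall>u\<in>rectangle n n. z (u + (int (n + k), 0)) = y u"
      by (auto simp: rectangle_def z_def)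
    ultimately show "\<exists>z\<in>?X. (\<forall>u\<in>rectangle n n. z u = x u) \<and>
        (\<forall>u\<in>rectangle n n. z (u + (int (n + k), 0)) = y u)" by blast
  next
    fix k x y assume x: "x \<in> ?X" and y: "y \<in> ?X"
    note xD = nn_shiftD[OF x[unfolded countdown_shift_def]]
      and yD = nn_shiftD[OF y[unfolded countdown_shift_def]]
    \<comment> \<open>Vertically every gap works, since the two half planes do not interact.\<close>
    define z where "z = (\<lambda>(i, j). if j < int n then x (i, j) else y (i, j - int (n + k)))"
    have "z \<in> ?X" unfolding countdown_shift_def
    proof (rule nn_shiftI)
      fix i j
      show "z (i, j) \<in> {0..c + 1}" "2 \<le> z (i, j) \<longrightarrow> z (i + 1, j) = z (i, j) - 1"
        using xD(1,2)[of i j] yD(1,2)[of i "j - int (n + k)"] by (auto simp: z_def)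
    qed simp
    moreover have "\<forall>u\<in>rectangle n n. z u = x u"
      "\<forall>u\<in>rectangle n n. z (u + (0, int (n + k))) = y u"
      by (auto simp: rectangle_def z_def)
    ultimately show "\<exists>z\<in>?X. (\<forall>u\<in>rectangle n n. z u = x u) \<and>
        (\<forall>u\<in>rectangle n n. z (u + (0, int (n + k))) = y u)" by blast
  qed
  show "enat c \<le> block_gluing ?X n"
  proof (rule block_gluing_ge_H, rule ccontr)
    fix k assume "glues_at ?X n (int (n + k), 0)" and "\<not> c \<le> k"
    \<comment> \<open>The largest symbol in the last column of the square sends the longest
      countdown into the gap. For k < c it still shows c - k > 0 in column n + k, where the all-zero
      pattern begins.\<close>
    define x :: "nat configuration" where
      "x = (\<lambda>(i, j). if i < int n - 1 then 0 else c + 1 - nat (i - (int n - 1)))"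
    have "x \<in> ?X" unfolding countdown_shift_def
    proof (rule nn_shiftI)
      fix i j
      have "nat (i + 1 - (int n - 1)) = Suc (nat (i - (int n - 1)))" if "int n - 1 \<le> i"
        using that by linarith
      then show "2 \<le> x (i, j) \<longrightarrow> x (i + 1, j) = x (i, j) - 1"
        by (auto simp: x_def)
    qed (auto simp: x_def)
    moreover have "(\<lambda>_. 0) \<in> ?X" by (auto simp: countdown_shift_def nn_shift_def)
    ultimately obtain z where z: "z \<in> ?X" and zx: "\<forall>u\<in>rectangle n n. z u = x u"
      and z0: "\<forall>u\<in>rectangle n n. z (u + (int (n + k), 0)) = 0"
      using bspec[OF bspec[OF \<open>glues_at ?X n _\<close>[unfolded glue]]] by blast
    note zD = nn_shiftD[OF z[unfolded countdown_shift_def]]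
    have "z (int n - 1 + int d, 0) = c + 1 - d" if "d \<le> c" for d
      using that
    proof (induction d)
      case 0
      then show ?case using zx assms by (force simp: rectangle_def x_def)
    next
      case (Suc d)
      then show ?case using zD(2)[of "int n - 1 + int d" 0] by (simp add: algebra_simps)
    qed
    from this[of "Suc k"] have "z (int (n + k), 0) = c + 1 - Suc k"
      using \<open>\<not> c \<le> k\<close> by (simp add: algebra_simps)
    moreover have "z (int (n + k), 0) = 0"
      using z0[rule_format, of "(0, 0)"] assms by (simp add: rectangle_def)
    ultimately show False using \<open>\<not> c \<le> k\<close> by simp
  qed
qed

section \<open>The shift of restartable pictures\<close>

text \<open>Outside its rectangle \<open>p\<close> is \<open>None\<close>, which is the border
  symbol, so the padded box may be replaced by the whole plane. This adds only pairs of two border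
  symbols, and such pairs already occur in a corner of the padding.\<close>

lemma in_domino_language_iff:
  "in_domino_language A H V m n p \<longleftrightarrow> is_picture A m n p \<and>
    (\<forall>i j. (p (i, j), p (i + 1, j)) \<notin> H \<and> (p (i, j), p (i, j + 1)) \<notin> V)"
proof (cases "is_picture A m n p")
  case True
  then have out: "p u = None" if "u \<notin> rectangle m n" for u
    using that by (auto simp: is_picture_def)
  have 1: "1 \<le> m" "1 \<le> n" using True by (auto simp: is_picture_def)
  let ?B = "{-1..int m} \<times> {-1..int n}"
  have pad: "padded m n p u = Some c \<longleftrightarrow> u \<in> ?B \<and> p u = c" for u c by (simp add: padded_def)
  have H: "(\<forall>d\<in>H. \<not> occurs_in (hdomino d) (padded m n p)) \<longleftrightarrow>
      (\<forall>i j. (p (i, j), p (i + 1, j)) \<notin> H)" (is "?L \<longleftrightarrow> ?R")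
  proof
    assume L: ?L
    have in_box: "(p (i, j), p (i + 1, j)) \<notin> H" if "(i, j) \<in> ?B" "(i + 1, j) \<in> ?B" for i j
    proof
      assume "(p (i, j), p (i + 1, j)) \<in> H"
      from bspec[OF L this] that show False
        unfolding occurs_in_hdomino pad fst_conv snd_conv by blast
    qed
    have "(p (-1, -1), p (-1 + 1, -1)) \<notin> H" using 1 by (intro in_box) auto
    then have none: "(None, None) \<notin> H" using out by (simp add: rectangle_def)
    show ?R
    proof (intro allI)
      fix i j
      show "(p (i, j), p (i + 1, j)) \<notin> H"
      proof (cases "(i, j) \<in> ?B \<and> (i + 1, j) \<in> ?B")
        case False
        then have "(i, j) \<notin> rectangle m n" "(i + 1, j) \<notin> rectangle m n"
          by (auto simp: rectangle_def)
        then show ?thesis using none out by simp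
      qed (use in_box in blast)
    qed
  qed (auto simp: occurs_in_hdomino pad)
  have V: "(\<forall>d\<in>V. \<not> occurs_in (vdomino d) (padded m n p)) \<longleftrightarrow>
      (\<forall>i j. (p (i, j), p (i, j + 1)) \<notin> V)" (is "?L \<longleftrightarrow> ?R")
  proof
    assume L: ?L
    have in_box: "(p (i, j), p (i, j + 1)) \<notin> V" if "(i, j) \<in> ?B" "(i, j + 1) \<in> ?B" for i j
    proof
      assume "(p (i, j), p (i, j + 1)) \<in> V"
      from bspec[OF L this] that show False
        unfolding occurs_in_vdomino pad fst_conv snd_conv by blast
    qed
    have "(p (-1, -1), p (-1, -1 + 1)) \<notin> V" using 1 by (intro in_box) auto
    then have none: "(None, None) \<notin> V" using out by (simp add: rectangle_def)
    show ?R
    proof (intro allI)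
      fix i j
      show "(p (i, j), p (i, j + 1)) \<notin> V"
      proof (cases "(i, j) \<in> ?B \<and> (i, j + 1) \<in> ?B")
        case False
        then have "(i, j) \<notin> rectangle m n" "(i, j + 1) \<notin> rectangle m n"
          by (auto simp: rectangle_def)
        then show ?thesis using none out by simp
      qed (use in_box in blast)
    qed
  qed (auto simp: occurs_in_vdomino pad)
  show ?thesis using True H V by (auto simp: in_domino_language_def)
qed (simp add: in_domino_language_def)

text \<open>Used to split the top row of a cut-out square into segments. Maximality is recorded by
  neighbours sharing the ends of their runs.\<close>

lemma maximal_runs:
  fixes D :: "int set"
  assumes "finite D"
  obtains lo hi where "\<And>i. i \<in> D \<Longrightarrow> lo i \<le> i \<and> i \<le> hi i \<and> {lo i..hi i} \<subseteq> D"
    and "\<And>i. i \<in> D \<Longrightarrow> i + 1 \<in> D \<Longrightarrow> lo (i + 1) = lo i \<and> hi (i + 1) = hi i"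
proof
  define run where "run i = {j. {min i j..max i j} \<subseteq> D}" for i
  show "Min (run i) \<le> i \<and> i \<le> Max (run i) \<and> {Min (run i)..Max (run i)} \<subseteq> D" if "i \<in> D" for i
  proof -
    have i: "i \<in> run i" using that by (simp add: run_def)
    have "run i \<subseteq> D" by (auto simp: run_def)
    then have fin: "finite (run i)" using assms finite_subset by blast
    have "Min (run i) \<in> run i" "Max (run i) \<in> run i" using fin i by (auto intro: Min_in Max_in)
    moreover have "Min (run i) \<le> i" "i \<le> Max (run i)" using fin i by auto
    moreover have "{j..i} \<subseteq> D" "{i..j} \<subseteq> D" if "j \<in> run i" for j
    proof -
      have "{j..i} \<subseteq> {min i j..max i j}" "{i..j} \<subseteq> {min i j..max i j}" by auto
      then show "{j..i} \<subseteq> D" "{i..j} \<subseteq> D" using that by (auto simp: run_def)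
    qed
    ultimately have "Min (run i) \<le> i" "i \<le> Max (run i)"
      "{Min (run i)..i} \<subseteq> D" "{i..Max (run i)} \<subseteq> D" by blast+
    moreover have "{Min (run i)..Max (run i)} \<subseteq> {Min (run i)..i} \<union> {i..Max (run i)}" by auto
    ultimately show ?thesis by blast
  qed
  show "Min (run (i + 1)) = Min (run i) \<and> Max (run (i + 1)) = Max (run i)"
    if "i \<in> D" "i + 1 \<in> D" for i
  proof -
    have "{min i j..max i j} \<subseteq> D \<longleftrightarrow> {min (i + 1) j..max (i + 1) j} \<subseteq> D" for j
    proof -
      \<comment> \<open>The intervals from i to j and from i + 1 to j differ only in i or i + 1,
        both of which lie in \<open>D\<close>.\<close>
      have "insert (i + 1) {min i j..max i j} \<union> {i} = insert (i + 1) {min (i + 1) j..max (i + 1) j} \<union> {i}"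
        by auto
      with that show ?thesis by (metis Un_subset_iff insert_subset empty_subsetI)
    qed
    then show ?thesis by (simp add: run_def)
  qed
qed

text \<open>The Booleans of \<open>Data\<close> mark the left wall, the right wall, the bottom row and the top row
  of a picture.\<close>

datatype cell = Blank | EraseL | EraseR | Data nat (lwall: bool) (rwall: bool) bool bool

instance cell :: countable
  by countable_datatype

text \<open>Of the facts about \<open>f\<close>, \<open>pictures_exist\<close> and
  \<open>f_mono\<close> carry the upper bound, and \<open>picture_height\<close> makes the lower
  bound possible.\<close>

locale picture_function =
  fixes A :: "nat set" and H V :: "(nat option \<times> nat option) set" and f :: "nat \<Rightarrow> nat"
  assumes finite_A: "finite A"
    and f_pos: "\<And>m. 0 < m \<Longrightarrow> 0 < f m"
    and f_mono: "\<And>m n. 0 < m \<Longrightarrow> m \<le> n \<Longrightarrow> f m \<le> f n"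
    and pictures_exist: "\<And>m. 0 < m \<Longrightarrow> \<exists>p. in_domino_language A H V m (f m) p"
    and picture_height: "\<And>m h p. in_domino_language A H V m h p \<Longrightarrow> h = f m"
begin

text \<open>Forbidden dominoes with one border symbol become conditions on a single cell: a wall,
  bottom or top mark stands for the adjacent \<open>#\<close>.\<close>

definition cells :: "cell set" where
  "cells = {Blank, EraseL, EraseR} \<union> {Data a l r b t | a l r b t. a \<in> A \<and>
     (l \<longrightarrow> (None, Some a) \<notin> H) \<and> (r \<longrightarrow> (Some a, None) \<notin> H) \<and>
     (b \<longrightarrow> (None, Some a) \<notin> V) \<and> (t \<longrightarrow> (Some a, None) \<notin> V)}"

text \<open>\<open>EraseL\<close> can end on its left, and \<open>EraseR\<close> on its right, only
  at a \<open>Blank\<close>. Neighbouring \<open>Data\<close> cells belong to the same row segment,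
  so they share the bottom and top marks and have no wall between them. A segment may also end
  without a wall.\<close>

definition hstep :: "cell \<Rightarrow> cell \<Rightarrow> bool" where
  "hstep s s' \<longleftrightarrow> (s' = EraseL \<longrightarrow> s = EraseL \<or> s = Blank) \<and>
     (s = EraseR \<longrightarrow> s' = EraseR \<or> s' = Blank) \<and>
     (\<forall>a l r b t a' l' r' b' t'. s = Data a l r b t \<and> s' = Data a' l' r' b' t' \<longrightarrow>
        \<not> r \<and> \<not> l' \<and> b = b' \<and> t = t' \<and> (Some a, Some a') \<notin> H)"

text \<open>A row reaching from wall to wall cannot be erased: an eraser would have to extend along the
  whole row and is stopped by the wall on its side.\<close>

definition vstep :: "cell \<Rightarrow> cell \<Rightarrow> bool" where
  "vstep s s' \<longleftrightarrow> (\<forall>a l r b. s = Data a l r b False \<longrightarrow>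
     (case s' of Blank \<Rightarrow> False | EraseL \<Rightarrow> \<not> l | EraseR \<Rightarrow> \<not> r
      | Data a' l' r' b' t' \<Rightarrow> l' = l \<and> r' = r \<and> (b' \<or> (Some a, Some a') \<notin> V)))"

definition X :: "cell configuration set" where
  "X = nn_shift cells hstep vstep"

lemma finite_cells: "finite cells"
proof -
  have "cells \<subseteq> {Blank, EraseL, EraseR} \<union>
      (\<lambda>(a, l, r, b, t). Data a l r b t) ` (A \<times> UNIV)"
    by (auto simp: cells_def image_iff)
  moreover have "finite (\<dots>)" using finite_A by simp
  ultimately show ?thesis by (rule finite_subset)
qed

lemma Data_in_cells: "Data a l r b t \<in> cells \<longleftrightarrow> a \<in> A \<and>
     (l \<longrightarrow> (None, Some a) \<notin> H) \<and> (r \<longrightarrow> (Some a, None) \<notin> H) \<and>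
     (b \<longrightarrow> (None, Some a) \<notin> V) \<and> (t \<longrightarrow> (Some a, None) \<notin> V)"
  by (simp add: cells_def)

lemma non_Data_in_cells [simp]: "Blank \<in> cells" "EraseL \<in> cells" "EraseR \<in> cells"
  by (simp_all add: cells_def)

lemma hstep_Blank [simp]: "hstep Blank s" "hstep s Blank"
  by (simp_all add: hstep_def)

lemma hstep_Erase [simp]: "hstep EraseL EraseL" "hstep EraseR EraseR"
  by (simp_all add: hstep_def)

lemma vstep_non_Data [simp]: "vstep Blank s" "vstep EraseL s" "vstep EraseR s"
  by (simp_all add: vstep_def)

lemma X_translate: "\<forall>x\<in>X. \<forall>w. (\<lambda>u. x (u + w)) \<in> X"
  unfolding X_def by (blast intro: nn_shift_translate)

lemmas glues_at_X = glues_at_iff[OF X_translate]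

lemmas XI = nn_shiftI[of _ cells hstep vstep, folded X_def]
lemmas XD = nn_shiftD[of _ cells hstep vstep, folded X_def]

subsection \<open>Single pictures\<close>

definition picture :: "nat \<Rightarrow> nat pattern" where
  "picture m = (SOME p. in_domino_language A H V m (f m) p)"

definition picture_cell :: "nat \<Rightarrow> int \<Rightarrow> int \<Rightarrow> cell" where
  "picture_cell m i j = (case picture m (i, j) of None \<Rightarrow> Blank
     | Some a \<Rightarrow> Data a (i = 0) (i = int m - 1) (j = 0) (j = int (f m) - 1))"

lemma picture_language:
  assumes "0 < m"
  shows "in_domino_language A H V m (f m) (picture m)"
  unfolding picture_def using someI_ex[OF pictures_exist[OF assms]] .

lemma picture_dominoes:
  assumes "0 < m"
  shows "(picture m (i, j), picture m (i + 1, j)) \<notin> H" "(picture m (i, j), picture m (i, j + 1)) \<notin> V"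
  using picture_language[OF assms] unfolding in_domino_language_iff by blast+

lemma picture_cases:
  assumes "0 < m"
  obtains (inside) a where "picture m (i, j) = Some a" "a \<in> A"
      "0 \<le> i" "i < int m" "0 \<le> j" "j < int (f m)"
    | (outside) "picture m (i, j) = None" "i < 0 \<or> int m \<le> i \<or> j < 0 \<or> int (f m) \<le> j"
proof -
  have "is_picture A m (f m) (picture m)"
    using picture_language[OF assms] unfolding in_domino_language_iff by blast
  then have "dom (picture m) = rectangle m (f m)" "ran (picture m) \<subseteq> A"
    by (auto simp: is_picture_def)
  then have "(i, j) \<in> dom (picture m) \<longleftrightarrow> (i, j) \<in> rectangle m (f m)"
    "\<And>a. picture m (i, j) = Some a \<Longrightarrow> a \<in> A" by (auto intro: ranI)
  then show thesis
    using that by (cases "picture m (i, j)") (auto simp: rectangle_def)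
qed

lemma picture_cell_in_X:
  assumes m: "0 < m"
  shows "(\<lambda>(i, j). picture_cell m i j) \<in> X"
proof (rule XI)
  fix i j
  note dom = picture_dominoes[OF m]
  show "(case (i, j) of (i, j) \<Rightarrow> picture_cell m i j) \<in> cells"
  using m proof (cases rule: picture_cases[where i = i and j = j])
    case (inside a)
    \<comment> \<open>Beyond the four edges the picture is \<open>None\<close>, so its dominoes
      yield the side conditions of the marked cells.\<close>
    have "picture m (-1, j) = None" by (cases rule: picture_cases[OF m, of "-1" j]) auto
    moreover have "picture m (int m, j) = None"
      by (cases rule: picture_cases[OF m, of "int m" j]) auto
    moreover have "picture m (i, -1) = None" by (cases rule: picture_cases[OF m, of i "-1"]) auto
    moreover have "picture m (i, int (f m)) = None"
      by (cases rule: picture_cases[OF m, of i "int (f m)"]) auto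
    ultimately show ?thesis
      using inside dom(1)[of "i - 1" j] dom(1)[of i j] dom(2)[of i "j - 1"] dom(2)[of i j]
      by (auto simp: picture_cell_def Data_in_cells)
  qed (simp add: picture_cell_def)
  show "hstep (case (i, j) of (i, j) \<Rightarrow> picture_cell m i j)
      (case (i + 1, j) of (i, j) \<Rightarrow> picture_cell m i j)"
  using m proof (cases rule: picture_cases[where i = i and j = j])
    case 1: (inside a)
    show ?thesis
    using m proof (cases rule: picture_cases[where i = "i + 1" and j = j])
      case (inside a')
      then show ?thesis using 1 dom(1)[of i j] by (simp add: picture_cell_def hstep_def)
    qed (simp add: picture_cell_def)
  qed (simp add: picture_cell_def)
  show "vstep (case (i, j) of (i, j) \<Rightarrow> picture_cell m i j)
      (case (i, j + 1) of (i, j) \<Rightarrow> picture_cell m i j)"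
  using m proof (cases rule: picture_cases[where i = i and j = j])
    case 1: (inside a)
    show ?thesis
    using m proof (cases rule: picture_cases[where i = i and j = "j + 1"])
      case (inside a')
      then show ?thesis using 1 dom(2)[of i j] by (simp add: picture_cell_def vstep_def)
    next
      \<comment> \<open>Upwards the picture can only be left from its top row, whose mark lifts the
        vertical rule.\<close>
      case outside
      then show ?thesis using 1 by (simp add: picture_cell_def vstep_def)
    qed
  qed (simp add: picture_cell_def)
qed

lemma picture_cell_Data:
  assumes "0 < m" "0 \<le> i" "i < int m" "0 \<le> j" "j < int (f m)"
  obtains a where "picture_cell m i j = Data a (i = 0) (i = int m - 1) (j = 0) (j = int (f m) - 1)"
  by (cases rule: picture_cases[OF assms(1), of i j]) (use assms that in \<open>auto simp: picture_cell_def\<close>)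

lemma picture_cell_Blank:
  assumes "0 < m" "int (f m) \<le> j"
  shows "picture_cell m i j = Blank"
  by (cases rule: picture_cases[OF assms(1), of i j]) (use assms in \<open>auto simp: picture_cell_def\<close>)

lemma picture_cell_in_cells:
  assumes "0 < m"
  shows "picture_cell m i j \<in> cells"
  using XD(1)[OF picture_cell_in_X[OF assms], of i j] by simp

subsection \<open>Upper bound\<close>

text \<open>Blanks to the left, to the right and below are always compatible with the cut-out
  square; only its top row makes demands on what lies above. A run of non-top \<open>Data\<close>
  cells there is erased in one row if one of its ends has no wall; a run with both walls is closed
  off by a whole new picture of its own width.\<close>

lemma completion:
  assumes x: "x \<in> X" and n: "0 < n"
  obtains z where "z \<in> X" "\<forall>u\<in>rectangle n n. z u = x u"
    "\<And>i j. z (i, j) \<noteq> Blank \<Longrightarrow> 0 \<le> i \<and> i < int n \<and> 0 \<le> j \<and> j < int (n + f n)"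
proof -
  let ?n = "int n"
  define D where "D = {i. 0 \<le> i \<and> i < ?n \<and> (\<exists>a l r b. x (i, ?n - 1) = Data a l r b False)}"
  have D_bound: "D \<subseteq> {0..<?n}" by (auto simp: D_def)
  then have "finite D" using finite_subset by blast
  then obtain lo hi where run: "\<And>i. i \<in> D \<Longrightarrow> lo i \<le> i \<and> i \<le> hi i \<and> {lo i..hi i} \<subseteq> D"
    and run_step: "\<And>i. i \<in> D \<Longrightarrow> i + 1 \<in> D \<Longrightarrow> lo (i + 1) = lo i \<and> hi (i + 1) = hi i"
    by (rule maximal_runs) blast
  \<comment> \<open>Adjacent \<open>Data\<close> cells have no wall between them, so a left wall can
    only stand at the left end of a run.\<close>
  have lwall: "lo i = i" if "i \<in> D" "x (i, ?n - 1) = Data a True r b t" for i a r b t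
  proof (rule ccontr)
    assume "lo i \<noteq> i"
    then have "i - 1 \<in> D" using run[OF that(1)] by auto
    then show False using XD(2)[OF x, of "i - 1" "?n - 1"] that by (auto simp: D_def hstep_def)
  qed
  have rwall: "hi i = i" if "i \<in> D" "x (i, ?n - 1) = Data a l True b t" for i a l b t
  proof (rule ccontr)
    assume "hi i \<noteq> i"
    then have "i + 1 \<in> D" using run[OF that(1)] by auto
    then show False using XD(2)[OF x, of "i" "?n - 1"] that by (auto simp: D_def hstep_def)
  qed
  define w where "w i = nat (hi i - lo i + 1)" for i
  \<comment> \<open>\<open>over i k\<close> is meant for row n + k. The picture begins with a bottom
    row, so it need not match the letters of \<open>x\<close> below it.\<close>
  define over where "over i k =
    (if \<not> lwall (x (lo i, ?n - 1)) then (if k = 0 then EraseL else Blank)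
     else if \<not> rwall (x (hi i, ?n - 1)) then (if k = 0 then EraseR else Blank)
     else picture_cell (w i) (i - lo i) k)" for i k
  have w: "0 < w i" "w i \<le> n" "int (w i) = hi i - lo i + 1" if "i \<in> D" for i
  proof -
    have "lo i \<in> D" "hi i \<in> D" using run[OF that] by auto
    then have "0 \<le> lo i" "hi i < ?n" using D_bound by auto
    then show "0 < w i" "w i \<le> n" "int (w i) = hi i - lo i + 1"
      using run[OF that] by (auto simp: w_def)
  qed
  have over_cells: "over i k \<in> cells" if "i \<in> D" for i k
    using picture_cell_in_cells[OF w(1)[OF that]] by (simp add: over_def)
  have over_h: "hstep (over i k) (over (i + 1) k)" if "i \<in> D" "i + 1 \<in> D" for i k
  proof -
    have lo: "lo (i + 1) = lo i" and hi: "hi (i + 1) = hi i" using run_step[OF that] by auto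
    have eqs: "i + 1 - lo i = i - lo i + 1" "w (i + 1) = w i" by (simp_all add: w_def lo hi)
    have "hstep (picture_cell (w i) (i - lo i) k) (picture_cell (w i) (i - lo i + 1) k)"
      using XD(2)[OF picture_cell_in_X[OF w(1)[OF that(1)]], of "i - lo i" k] by simp
    then show ?thesis unfolding over_def lo hi eqs by simp
  qed
  have over_v: "vstep (over i k) (over i (k + 1))" if "i \<in> D" for i k
    using XD(3)[OF picture_cell_in_X[OF w(1)[OF that]], of "i - lo i" k]
    by (auto simp: over_def)
  have over_0: "vstep (x (i, ?n - 1)) (over i 0)" if i: "i \<in> D" for i
  proof -
    obtain a l r b where xi: "x (i, ?n - 1) = Data a l r b False"
      using i by (auto simp: D_def)
    \<comment> \<open>A cell has a left wall only at a walled left end of its run. This agrees with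
      the walls of the new picture, and it permits \<open>EraseL\<close> when that end is
      open.\<close>
    have l: "l \<longleftrightarrow> lo i = i \<and> lwall (x (lo i, ?n - 1))"
      using lwall[OF i, of a r b False] xi by (cases l) auto
    have r: "r \<longleftrightarrow> hi i = i \<and> rwall (x (hi i, ?n - 1))"
      using rwall[OF i, of a l b False] xi by (cases r) auto
    obtain a' where "picture_cell (w i) (i - lo i) 0 =
        Data a' (i = lo i) (i = hi i) True (0 = int (f (w i)) - 1)"
      using picture_cell_Data[of "w i" "i - lo i" 0] run[OF i] w[OF i] f_pos[OF w(1)[OF i]]
      by (auto simp: algebra_simps)
    then show ?thesis using l r xi by (auto simp: over_def vstep_def)
  qed
  have over_Blank: "over i k = Blank" if "i \<in> D" "int (f n) \<le> k" for i k
  proof -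
    \<comment> \<open>Monotonicity enters here: a run is no wider than the square. An eraser row
      fits because \<open>f n\<close> is positive.\<close>
    have "f (w i) \<le> f n" using w[OF that(1)] by (intro f_mono) auto
    then show ?thesis using that picture_cell_Blank[OF w(1)[OF that(1)], of k] f_pos[OF n]
      by (auto simp: over_def)
  qed
  define z where "z = (\<lambda>(i, j). if 0 \<le> i \<and> i < ?n \<and> 0 \<le> j \<and> j < ?n then x (i, j)
    else if ?n \<le> j \<and> i \<in> D then over i (j - ?n) else Blank)"
  have "z \<in> X"
  proof (rule XI)
    fix i j
    show "z (i, j) \<in> cells" using XD(1)[OF x] over_cells by (auto simp: z_def)
    show "hstep (z (i, j)) (z (i + 1, j))"
      using XD(2)[OF x, of i j] over_h[of i "j - ?n"] by (auto simp: z_def)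
    have "vstep (x (i, ?n - 1)) Blank" if "i \<notin> D" "0 \<le> i" "i < ?n"
      using that by (auto simp: D_def vstep_def)
    moreover have "vstep (over i (j - ?n)) (over i (j + 1 - ?n))" if "i \<in> D"
    proof -
      have "j + 1 - ?n = j - ?n + 1" by simp
      then show ?thesis using over_v[OF that, of "j - ?n"] by metis
    qed
    moreover have "j + 1 = ?n \<longleftrightarrow> j = ?n - 1" by auto
    ultimately show "vstep (z (i, j)) (z (i, j + 1))"
      using XD(3)[OF x, of i j] over_0[of i] D_bound
      by (cases "j = ?n - 1") (auto simp: z_def)
  qed
  moreover have "\<forall>u\<in>rectangle n n. z u = x u" by (auto simp: rectangle_def z_def)
  moreover have "0 \<le> i \<and> i < ?n \<and> 0 \<le> j \<and> j < int (n + f n)" if "z (i, j) \<noteq> Blank" for i j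
  proof -
    from that consider "0 \<le> i \<and> i < ?n \<and> 0 \<le> j \<and> j < ?n"
      | "?n \<le> j" "i \<in> D" "over i (j - ?n) \<noteq> Blank"
      by (auto simp: z_def split: if_splits)
    then show ?thesis
    proof cases
      case 2
      then have "\<not> int (f n) \<le> j - ?n" "i \<in> {0..<?n}" using over_Blank D_bound by blast+
      then show ?thesis using 2(1) by auto
    qed simp
  qed
  ultimately show thesis by (rule that)
qed

text \<open>No two neighbouring cells see both configurations: each such pair can be read in
  \<open>x\<close> alone or in \<open>y\<close> alone, where the rules hold already.\<close>

lemma glue_separated:
  assumes x: "x \<in> X" and y: "y \<in> X"
    and sep: "\<And>i j i' j'. x (i, j) \<noteq> Blank \<Longrightarrow> y (i', j') \<noteq> Blank \<Longrightarrow> 1 < \<bar>i - i'\<bar> + \<bar>j - j'\<bar>"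
  shows "(\<lambda>u. if x u = Blank then y u else x u) \<in> X" (is "?z \<in> X")
proof -
  have y_Blank: "y (i', j') = Blank" if "x (i, j) \<noteq> Blank" "\<bar>i - i'\<bar> + \<bar>j - j'\<bar> \<le> 1" for i j i' j'
  proof (rule ccontr)
    assume "y (i', j') \<noteq> Blank"
    from sep[OF that(1) this] that(2) show False by linarith
  qed
  have *: "(?z (i, j) = x (i, j) \<and> ?z (i', j') = x (i', j')) \<or>
      (?z (i, j) = y (i, j) \<and> ?z (i', j') = y (i', j'))" if near: "\<bar>i - i'\<bar> + \<bar>j - j'\<bar> \<le> 1" for i j i' j'
  proof -
    have near': "\<bar>i' - i\<bar> + \<bar>j' - j\<bar> \<le> 1" using near by linarith
    consider "x (i, j) \<noteq> Blank" | "x (i', j') \<noteq> Blank" | "x (i, j) = Blank" "x (i', j') = Blank" by blast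
    then show ?thesis
    proof cases
      case 1
      then show ?thesis using y_Blank[OF 1 near] by simp
    next
      case 2
      then show ?thesis using y_Blank[OF 2 near'] by simp
    qed simp
  qed
  show ?thesis
  proof (rule XI)
    fix i j
    show "?z (i, j) \<in> cells" using XD(1)[OF x] XD(1)[OF y] by simp
    show "hstep (?z (i, j)) (?z (i + 1, j))"
    proof -
      consider "?z (i, j) = x (i, j)" "?z (i + 1, j) = x (i + 1, j)"
        | "?z (i, j) = y (i, j)" "?z (i + 1, j) = y (i + 1, j)"
        using *[of i "i + 1" j j] by auto
      then show ?thesis
        by cases (simp_all only: XD(2)[OF x] XD(2)[OF y])
    qed
    show "vstep (?z (i, j)) (?z (i, j + 1))"
    proof -
      consider "?z (i, j) = x (i, j)" "?z (i, j + 1) = x (i, j + 1)"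
        | "?z (i, j) = y (i, j)" "?z (i, j + 1) = y (i, j + 1)"
        using *[of i i j "j + 1"] by auto
      then show ?thesis
        by cases (simp_all only: XD(3)[OF x] XD(3)[OF y])
    qed
  qed
qed

text \<open>Completed patterns lie within height \<open>n + f n\<close>, so the additional 1 in
  \<open>f n + 1\<close> leaves an empty row between them. Horizontally, completion adds no
  width.\<close>

lemma glues_at_separated:
  assumes n: "0 < n"
    and v: "a = int (n + k) \<and> b = 0 \<or> a = 0 \<and> b = int (n + k)" and k: "f n + 1 \<le> k"
  shows "glues_at X n (a, b)"
  unfolding glues_at_X
proof (intro ballI)
  fix x y assume "x \<in> X" "y \<in> X"
  obtain x' where x': "x' \<in> X" "\<forall>u\<in>rectangle n n. x' u = x u"
    "\<And>i j. x' (i, j) \<noteq> Blank \<Longrightarrow> 0 \<le> i \<and> i < int n \<and> 0 \<le> j \<and> j < int (n + f n)"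
    using completion[OF \<open>x \<in> X\<close> n] by blast
  obtain y' where y': "y' \<in> X" "\<forall>u\<in>rectangle n n. y' u = y u"
    "\<And>i j. y' (i, j) \<noteq> Blank \<Longrightarrow> 0 \<le> i \<and> i < int n \<and> 0 \<le> j \<and> j < int (n + f n)"
    using completion[OF \<open>y \<in> X\<close> n] by blast
  define y'' where "y'' = (\<lambda>u. y' (u + (-a, -b)))"
  have y'': "y'' \<in> X" unfolding y''_def using X_translate y'(1) by blast
  have sep: "1 < \<bar>i - i'\<bar> + \<bar>j - j'\<bar>" if "x' (i, j) \<noteq> Blank" "y'' (i', j') \<noteq> Blank" for i j i' j'
    using x'(3)[OF that(1)] y'(3)[of "i' - a" "j' - b"] that(2) v k by (auto simp: y''_def)
  define z where "z = (\<lambda>u. if x' u = Blank then y'' u else x' u)"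
  have "z \<in> X" unfolding z_def using glue_separated[OF x'(1) y'' sep] .
  moreover have "z (i, j) = x (i, j)" if "(i, j) \<in> rectangle n n" for i j
  proof -
    have "\<not> (0 \<le> i - a \<and> 0 \<le> j - b)" using that v by (auto simp: rectangle_def)
    then have "y' (i - a, j - b) = Blank" using y'(3) by blast
    then have "y'' (i, j) = Blank" by (simp add: y''_def)
    then show ?thesis using x'(2) that by (auto simp: z_def)
  qed
  moreover have "z (i + a, j + b) = y (i, j)" if "(i, j) \<in> rectangle n n" for i j
  proof -
    have "\<not> (i + a < int n \<and> j + b < int (n + f n))" using that v k by (auto simp: rectangle_def)
    then have "x' (i + a, j + b) = Blank" using x'(3) by blast
    then show ?thesis using y'(2) that by (simp add: z_def y''_def)
  qed
  ultimately show "\<exists>z\<in>X. (\<forall>u\<in>rectangle n n. z u = x u) \<and>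
      (\<forall>u\<in>rectangle n n. z (u + (a, b)) = y u)" by (intro bexI[of _ z]) auto
qed

lemma block_gluing_X_le: "0 < n \<Longrightarrow> block_gluing X n \<le> enat (f n + 1)"
  using glues_at_separated[of n] by (auto intro!: block_gluing_le)

subsection \<open>Lower bound\<close>

definition closed_row :: "cell configuration \<Rightarrow> nat \<Rightarrow> int \<Rightarrow> bool \<Rightarrow> bool \<Rightarrow> bool" where
  "closed_row x m j b t \<longleftrightarrow>
     (\<forall>i\<in>{0..<int m}. \<exists>a. x (i, j) = Data a (i = 0) (i = int m - 1) b t)"

text \<open>Above a non-top row only erasers compete with \<open>Data\<close>, and an eraser would
  extend to the end of the row on its own side, where the wall forbids it. So all cells above are
  \<open>Data\<close>, and neighbours share their bottom and top marks.\<close>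

lemma closed_row_step:
  assumes x: "x \<in> X" and m: "0 < m" and row: "closed_row x m j b False"
  obtains b' t' where "closed_row x m (j + 1) b' t'"
proof -
  let ?c = "\<lambda>i. x (int i, j + 1)"
  have D: "?c i = EraseL \<and> i \<noteq> 0 \<or> ?c i = EraseR \<and> i \<noteq> m - 1 \<or>
      (\<exists>a b t. ?c i = Data a (i = 0) (i = m - 1) b t)" if i: "i < m" for i
  proof -
    obtain a where "x (int i, j) = Data a (i = 0) (int i = int m - 1) b False"
      using bspec[OF row[unfolded closed_row_def], of "int i"] i by auto
    moreover have "int i = int m - 1 \<longleftrightarrow> i = m - 1" using m by auto
    ultimately show ?thesis
      using XD(3)[OF x, of "int i" j] by (cases "?c i") (auto simp: vstep_def)
  qed
  have h: "hstep (?c i) (?c (Suc i))" for i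
    using XD(2)[OF x, of "int i" "j + 1"] by (simp add: add.commute)
  \<comment> \<open>Induction starting at the left wall; \<open>noR\<close> is the mirror image,
    counted from the right wall.\<close>
  have noL: "?c i \<noteq> EraseL" if "i < m" for i
    using that
  proof (induction i)
    case (Suc i)
    then show ?case using h[of i] D[of i] by (auto simp: hstep_def)
  qed (use D[of 0] in auto)
  have noR: "?c (m - 1 - i) \<noteq> EraseR" if "i < m" for i
    using that
  proof (induction i)
    case (Suc i)
    then have "Suc (m - 1 - Suc i) = m - 1 - i" by simp
    then show ?case using h[of "m - 1 - Suc i"] D[of "m - 1 - i"] noL[of "m - 1 - i"] Suc
      by (auto simp: hstep_def)
  qed (use D[of "m - 1"] m in auto)
  have D': "\<exists>a b t. ?c i = Data a (i = 0) (i = m - 1) b t" if "i < m" for i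
    using D[OF that] noL[OF that] noR[of "m - 1 - i"] that by auto
  obtain a b' t' where 0: "?c 0 = Data a True (0 = m - 1) b' t'" using D'[OF m] by auto
  have data: "\<exists>a. ?c i = Data a (i = 0) (i = m - 1) b' t'" if "i < m" for i
    using that
  proof (induction i)
    case (Suc i)
    then show ?case using h[of i] D'[of "Suc i"] by (auto simp: hstep_def)
  qed (use 0 in auto)
  have row': "\<exists>a. ?c i = Data a (int i = 0) (int i = int m - 1) b' t'" if "i < m" for i
  proof -
    have "int i = int m - 1 \<longleftrightarrow> i = m - 1" using m by auto
    then show ?thesis using data[OF that] by simp
  qed
  have "\<exists>a. x (i, j + 1) = Data a (i = 0) (i = int m - 1) b' t'" if "i \<in> {0..<int m}" for i
    using row'[of "nat i"] that by auto
  then have "closed_row x m (j + 1) b' t'" by (simp add: closed_row_def)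
  then show thesis by (rule that)
qed

text \<open>Reading off the letters gives a picture of the language: the walls and the bottom and
  top marks take care of the border dominoes. Its width then determines its height.\<close>

lemma closed_rows_height:
  assumes x: "x \<in> X" and m: "0 < m"
    and rows: "\<And>k. k < h \<Longrightarrow> closed_row x m (j0 + int k) (k = 0) (k = h - 1)" and h: "0 < h"
  shows "h = f m"
proof (rule picture_height)
  define p :: "nat pattern" where "p = (\<lambda>(i, j). if (i, j) \<in> rectangle m h
    then (case x (i, j0 + j) of Data a l r b t \<Rightarrow> Some a | _ \<Rightarrow> None) else None)"
  have inside: "\<exists>a. p (i, j) = Some a \<and> a \<in> A \<and>
      x (i, j0 + j) = Data a (i = 0) (i = int m - 1) (j = 0) (j = int h - 1) \<and>
      Data a (i = 0) (i = int m - 1) (j = 0) (j = int h - 1) \<in> cells"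
    if "(i, j) \<in> rectangle m h" for i j
  proof -
    have j: "0 \<le> j" "nat j < h" "i \<in> {0..<int m}" using that by (auto simp: rectangle_def)
    then have eq: "nat j = 0 \<longleftrightarrow> j = 0" "nat j = h - 1 \<longleftrightarrow> j = int h - 1" using h by auto
    obtain a where a: "x (i, j0 + j) = Data a (i = 0) (i = int m - 1) (j = 0) (j = int h - 1)"
      using bspec[OF rows[OF j(2), unfolded closed_row_def eq] j(3)] j(1) by auto
    moreover have "x (i, j0 + j) \<in> cells" by (rule XD(1)[OF x])
    ultimately show ?thesis using that by (auto simp: p_def Data_in_cells)
  qed
  have outside: "p (i, j) = None" if "(i, j) \<notin> rectangle m h" for i j
    using that by (simp add: p_def)
  have "dom p = rectangle m h"
  proof (intro equalityI subsetI)
    fix u assume "u \<in> rectangle m h"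
    then show "u \<in> dom p" using inside[of "fst u" "snd u"] by auto
  qed (auto simp: p_def split: if_splits)
  moreover have "ran p \<subseteq> A"
  proof
    fix a assume "a \<in> ran p"
    then obtain i j where ij: "p (i, j) = Some a" by (auto simp: ran_def)
    then have "(i, j) \<in> rectangle m h" using outside by force
    then show "a \<in> A" using inside[of i j] ij by auto
  qed
  ultimately have pic: "is_picture A m h p" using m h by (simp add: is_picture_def)
  have "picture m (i, j) = None" if "i < 0" for i j
    by (cases rule: picture_cases[OF m, of i j]) (use that in auto)
  \<comment> \<open>To the left of \<open>picture m\<close> border symbols are adjacent to each
    other, so such pairs are not forbidden.\<close>
  then have none: "(None, None) \<notin> H" "(None, None) \<notin> V"
    using picture_dominoes[OF m, of "-2" 0] by simp_all
  have "(p (i, j), p (i + 1, j)) \<notin> H" for i j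
  proof (cases "(i, j) \<in> rectangle m h"; cases "(i + 1, j) \<in> rectangle m h")
    assume *: "(i, j) \<in> rectangle m h" "(i + 1, j) \<in> rectangle m h"
    show ?thesis
      using inside[OF *(1)] inside[OF *(2)] XD(2)[OF x, of i "j0 + j"] by (auto simp: hstep_def)
  next
    assume *: "(i, j) \<in> rectangle m h" "(i + 1, j) \<notin> rectangle m h"
    then have "i = int m - 1" by (auto simp: rectangle_def)
    then show ?thesis using inside[OF *(1)] outside[OF *(2)] by (auto simp: Data_in_cells)
  next
    assume *: "(i, j) \<notin> rectangle m h" "(i + 1, j) \<in> rectangle m h"
    then have "i + 1 = 0" by (auto simp: rectangle_def)
    then show ?thesis using inside[OF *(2)] outside[OF *(1)] by (auto simp: Data_in_cells)
  qed (use outside none in simp)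
  moreover have "(p (i, j), p (i, j + 1)) \<notin> V" for i j
  proof (cases "(i, j) \<in> rectangle m h"; cases "(i, j + 1) \<in> rectangle m h")
    assume *: "(i, j) \<in> rectangle m h" "(i, j + 1) \<in> rectangle m h"
    \<comment> \<open>Row j of \<open>p\<close> is not its top row and row j + 1 is not its bottom
      row, so \<open>vstep\<close> does impose the domino condition.\<close>
    then have "j \<noteq> int h - 1" "j + 1 \<noteq> 0" by (auto simp: rectangle_def)
    then show ?thesis
      using inside[OF *(1)] inside[OF *(2)] XD(3)[OF x, of i "j0 + j"]
      by (auto simp: vstep_def add.assoc)
  next
    assume *: "(i, j) \<in> rectangle m h" "(i, j + 1) \<notin> rectangle m h"
    then have "j = int h - 1" by (auto simp: rectangle_def)
    then show ?thesis using inside[OF *(1)] outside[OF *(2)] by (auto simp: Data_in_cells)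
  next
    assume *: "(i, j) \<notin> rectangle m h" "(i, j + 1) \<in> rectangle m h"
    then have "j + 1 = 0" by (auto simp: rectangle_def)
    then show ?thesis using inside[OF *(2)] outside[OF *(1)] by (auto simp: Data_in_cells)
  qed (use outside none in simp)
  ultimately show "in_domino_language A H V m h p"
    unfolding in_domino_language_iff using pic by blast
qed

text \<open>Restarts can only postpone the end: closed rows follow each other up to the first top
  row, and the rows from the last restart to that top row form a complete picture of height
  \<open>f m\<close>. All of them lie below the blank cell.\<close>

lemma base_row_height:
  assumes x: "x \<in> X" and m: "0 < m" and row: "closed_row x m j True t"
    and blank: "x (0, j + int k) = Blank"
  shows "f m \<le> k"
proof -
  text \<open>Row \<open>j + i\<close> is the last restart up to row \<open>j + d\<close>.\<close>
  have "f m \<le> d \<or> (\<exists>i\<le>d. (\<forall>e\<in>{i..<d}. closed_row x m (j + int e) (e = i) False) \<and>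
      (\<exists>t. closed_row x m (j + int d) (d = i) t))" for d
  proof (induction d)
    case 0
    then show ?case using row by auto
  next
    case (Suc d)
    then consider "f m \<le> d" | i t where "i \<le> d" "\<forall>e\<in>{i..<d}. closed_row x m (j + int e) (e = i) False"
      "closed_row x m (j + int d) (d = i) t" by blast
    then show ?case
    proof cases
      case (2 i t)
      show ?thesis
      proof (cases t)
        case True
        have "Suc d - i = f m"
        proof (rule closed_rows_height[OF x m, of _ "j + int i"])
          fix e assume "e < Suc d - i"
          then have e: "i + e \<le> d" using 2(1) by simp
          then have "closed_row x m (j + int (i + e)) (i + e = i) (i + e = d)"
            using 2(1,3) bspec[OF 2(2), of "i + e"] True by (cases "i + e = d") auto
          moreover have "i + e = d \<longleftrightarrow> e = Suc d - i - 1" using 2(1) by auto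
          ultimately show "closed_row x m (j + int i + int e) (e = 0) (e = Suc d - i - 1)"
            by (simp add: add.assoc)
        qed (use 2 in simp)
        then have "f m \<le> Suc d" by linarith
        then show ?thesis by blast
      next
        case False
        then obtain b' t' where next_row: "closed_row x m (j + int (Suc d)) b' t'"
          using closed_row_step[OF x m, of "j + int d" "d = i"] 2(3) by (auto simp: ac_simps)
        have "\<forall>e\<in>{i..<Suc d}. closed_row x m (j + int e) (e = i) False"
          using 2 False by (auto simp: less_Suc_eq)
        moreover have "Suc d \<noteq> i" using 2(1) by simp
        ultimately show ?thesis
          using next_row 2(1)
          \<comment> \<open>The last restart moves to the new row exactly if that row is marked as a
            bottom row.\<close>
          by (intro disjI2 exI[of _ "if b' then Suc d else i"]) auto
      qed
    qed simp
  qed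
  moreover have "\<not> closed_row x m (j + int k) b t" for b t
  proof
    assume "closed_row x m (j + int k) b t"
    from bspec[OF this[unfolded closed_row_def], of 0] show False using blank m by auto
  qed
  ultimately show ?thesis by blast
qed

text \<open>The first square shows only the bottom row of a picture of width \<open>n\<close>,
  placed in the top row of the square; the second square is blank. At least \<open>f n - 1\<close>
  further rows have to fit into the gap.\<close>

lemma block_gluing_X_ge:
  assumes n: "0 < n"
  shows "enat (f n - 1) \<le> block_gluing X n"
proof (rule block_gluing_ge_V)
  fix k assume "glues_at X n (0, int (n + k))"
  let ?x = "\<lambda>u. (\<lambda>(i, j). picture_cell n i j) (u + (0, 1 - int n))"
  have "?x \<in> X" using X_translate picture_cell_in_X[OF n] by blast
  moreover have "(\<lambda>_. Blank) \<in> X" by (rule XI) auto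
  ultimately obtain z where z: "z \<in> X" and zx: "\<forall>u\<in>rectangle n n. z u = ?x u"
    and z0: "\<forall>u\<in>rectangle n n. z (u + (0, int (n + k))) = Blank"
    using bspec[OF bspec[OF \<open>glues_at X n _\<close>[unfolded glues_at_X]]] by blast
  have "closed_row z n (int n - 1) True (0 = int (f n) - 1)"
    unfolding closed_row_def
  proof
    fix i assume i: "i \<in> {0..<int n}"
    then have "z (i, int n - 1) = picture_cell n i 0"
      using zx n by (auto simp: rectangle_def)
    moreover obtain a where
      "picture_cell n i 0 = Data a (i = 0) (i = int n - 1) (0 = (0 :: int)) (0 = int (f n) - 1)"
      using i f_pos[OF n] by (auto intro: picture_cell_Data[OF n, of i 0])
    ultimately show "\<exists>a. z (i, int n - 1) = Data a (i = 0) (i = int n - 1) True (0 = int (f n) - 1)"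
      by simp
  qed
  moreover have "z (0, int n - 1 + int (Suc k)) = Blank"
    using z0[rule_format, of "(0, 0)"] n by (simp add: rectangle_def)
  ultimately have "f n \<le> Suc k" by (rule base_row_height[OF z n])
  then show "f n - 1 \<le> k" by simp
qed

end

section \<open>The limit of the ratio for bounded and for unbounded functions\<close>

theorem theorem2:
  fixes f :: "nat \<Rightarrow> nat"
  assumes "\<And>m. 0 < m \<Longrightarrow> 0 < f m"
    and "mono_on {0<..} f"
    and "recognizable_function f"
  shows "\<exists>(A :: nat set) X. is_SFT A X \<and>
    (\<lambda>n. ereal_of_enat (block_gluing X n) / ereal (real (f n))) \<longlonglongrightarrow> 1"
proof -
  obtain A H V where fin: "finite (A :: nat set)"
    and R: "{(m, f m) | m. 0 < m} = {(m, n). \<exists>p. in_domino_language A H V m n p}"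
    using assms(3) unfolding recognizable_function_def recognizable_def by blast
  have R_iff: "(\<exists>p. in_domino_language A H V m h p) \<longleftrightarrow> 0 < m \<and> h = f m" for m h
  proof -
    have "(\<exists>p. in_domino_language A H V m h p) \<longleftrightarrow> (m, h) \<in> {(m, f m) | m. 0 < m}"
      unfolding R by simp
    then show ?thesis by blast
  qed
  have mono: "f m \<le> f n" if "0 < m" "m \<le> n" for m n
    using assms(2) that by (auto simp: mono_on_def)
  interpret picture_function A H V f
  proof
    show "h = f m" if "in_domino_language A H V m h p" for m h p
      using R_iff that by blast
  qed (use fin assms(1) mono R_iff in auto)
  show ?thesis
  \<comment> \<open>For bounded \<open>f\<close> an additive error of 1 does not vanish in the
    ratio, so that case needs the exact value.\<close>
  proof (cases "\<exists>c. \<forall>n>0. f n \<le> c")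
    case True
    then obtain c where "\<forall>n>0. f n \<le> c" by blast
    then have fin_f: "finite (f ` {0<..})" by (auto intro: finite_subset[of _ "{..c}"])
    then have "Max (f ` {0<..}) \<in> f ` {0<..}" by (intro Max_in) auto
    \<comment> \<open>A nondecreasing function that attains its maximum at \<open>N\<close> is
      constant from there on.\<close>
    then obtain N where N: "0 < N" "f N = Max (f ` {0<..})" by auto
    have const: "f n = f N" if "N \<le> n" for n
      using fin_f N mono[OF N(1) that] that by (auto intro!: antisym)
    have gluing: "block_gluing (countdown_shift (f N)) n = enat (f n)" if "N \<le> n" for n
      using block_gluing_countdown_shift[of n "f N"] N(1) that by (simp add: const[OF that])
    have "\<forall>\<^sub>F n in sequentially.
        ereal_of_enat (block_gluing (countdown_shift (f N)) n) / ereal (real (f n)) = 1"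
    proof (rule eventually_sequentiallyI)
      fix n assume "N \<le> n"
      then have "0 < f n" using assms(1) N(1) by simp
      then show "ereal_of_enat (block_gluing (countdown_shift (f N)) n) / ereal (real (f n)) = 1"
        by (simp add: gluing[OF \<open>N \<le> n\<close>] one_ereal_def)
    qed
    then have "(\<lambda>n. ereal_of_enat (block_gluing (countdown_shift (f N)) n) / ereal (real (f n)))
        \<longlonglongrightarrow> 1"
      by (rule tendsto_eventually)
    moreover have "is_SFT {0..f N + 1} (countdown_shift (f N))"
      unfolding countdown_shift_def by (rule is_SFT_nn_shift) simp
    ultimately show ?thesis by blast
  next
    case False
    \<comment> \<open>Monotonicity turns unboundedness into divergence to infinity.\<close>
    have f_top: "filterlim f at_top sequentially"
      unfolding filterlim_at_top
    proof
      fix c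
      obtain N where "0 < N" "c < f N" using False by (meson not_le)
      then have "c \<le> f n" if "N \<le> n" for n using mono[OF _ that] by simp
      then show "\<forall>\<^sub>F n in sequentially. c \<le> f n" by (rule eventually_sequentiallyI)
    qed
    \<comment> \<open>The alphabet has to consist of natural numbers; \<open>to_nat\<close> encodes
      the cells without changing the gluing function.\<close>
    let ?Y = "(\<lambda>x. to_nat \<circ> x) ` X"
    have Y: "block_gluing ?Y n = block_gluing X n" for n
      by (rule block_gluing_rename) (use X_translate in auto)
    \<comment> \<open>For n > 0 the gluing function is finite by the upper bound, so the limit can
      be taken in the reals.\<close>
    define g where "g n = the_enat (block_gluing X n)" for n
    have g: "block_gluing X n = enat (g n)" "f n - 1 \<le> g n" "g n \<le> f n + 1" if "0 < n" for n
    proof -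
      show eq: "block_gluing X n = enat (g n)"
        using enat_ile[OF block_gluing_X_le[OF that]] by (auto simp: g_def)
      show "f n - 1 \<le> g n" "g n \<le> f n + 1"
        using block_gluing_X_le[OF that] block_gluing_X_ge[OF that] by (simp_all add: eq)
    qed
    have real_f: "filterlim (\<lambda>n. real (f n)) at_top sequentially"
      using filterlim_compose[OF filterlim_real_sequentially f_top] .
    have "(\<lambda>n. real (g n) / real (f n)) \<longlonglongrightarrow> 1"
    proof (rule tendsto_sandwich)
      have "1 - 1 / real (f n) \<le> real (g n) / real (f n) \<and>
          real (g n) / real (f n) \<le> 1 + 1 / real (f n)" if "1 \<le> n" for n
      proof -
        have "0 < f n" "real (f n) - 1 \<le> real (g n)" "real (g n) \<le> real (f n) + 1"
          using assms(1)[of n] g(2,3)[of n] that by auto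
        moreover from this(1) have "1 - 1 / real (f n) = (real (f n) - 1) / real (f n)"
          "1 + 1 / real (f n) = (real (f n) + 1) / real (f n)" by (simp_all add: field_simps)
        ultimately show ?thesis by (simp add: divide_right_mono)
      qed
      then show "\<forall>\<^sub>F n in sequentially. 1 - 1 / real (f n) \<le> real (g n) / real (f n)"
        "\<forall>\<^sub>F n in sequentially. real (g n) / real (f n) \<le> 1 + 1 / real (f n)"
        by (auto intro: eventually_sequentiallyI[of 1])
      have "(\<lambda>n. 1 / real (f n)) \<longlonglongrightarrow> 0"
        using tendsto_divide_0[OF tendsto_const filterlim_at_top_imp_at_infinity[OF real_f]] .
      from tendsto_diff[OF tendsto_const this, of 1] tendsto_add[OF tendsto_const this, of 1]
      show "(\<lambda>n. 1 - 1 / real (f n)) \<longlonglongrightarrow> 1" "(\<lambda>n. 1 + 1 / real (f n)) \<longlonglongrightarrow> 1" by simp_all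
    qed
    then have "(\<lambda>n. ereal (real (g n) / real (f n))) \<longlonglongrightarrow> 1" by (simp add: one_ereal_def)
    moreover have "\<forall>\<^sub>F n in sequentially. ereal (real (g n) / real (f n)) =
        ereal_of_enat (block_gluing ?Y n) / ereal (real (f n))"
    proof (rule eventually_sequentiallyI)
      fix n :: nat assume "1 \<le> n"
      then have "0 < f n" "block_gluing X n = enat (g n)" using assms(1) g(1) by simp_all
      then show "ereal (real (g n) / real (f n)) =
          ereal_of_enat (block_gluing ?Y n) / ereal (real (f n))"
        by (simp add: Y)
    qed
    ultimately have "(\<lambda>n. ereal_of_enat (block_gluing ?Y n) / ereal (real (f n))) \<longlonglongrightarrow> 1"
      by (rule Lim_transform_eventually)
    moreover have "is_SFT (to_nat ` cells) ?Y"
      unfolding X_def nn_shift_rename[OF inj_to_nat]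
      by (rule is_SFT_nn_shift) (simp add: finite_cells)
    ultimately show ?thesis by blast
  qed
qed

end
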